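(* Suppose that the process $(X(t),Y(t))_{t\ge 0}$ described in the context is ergodic, so that it has a stationary ergodic version, and that for this stationary version the average intensity $\lambda := E[\lambda(t)]$ satisfies $0<\lambda<\infty$. Then $$\frac{k}{\alpha}<1 .$$
   Context: Constants: $c>0$, $\alpha>0$, $k>0$. The function $\varphi:(-\infty,\infty)\to[0,\infty)$ is non-decreasing with $\lim_{x\to-\infty}\varphi(x)=0$ and $\lim_{x\to\infty}\varphi(x)=\infty$, and it satisfies one of the following: (a) $\varphi$ is strictly positive everywhere, or (b) $\varphi$ equals zero for all $x$ below some level and is otherwise strictly increasing. Let $\Pi$ be a Poisson field (Poisson random measure) of intensity $1$ on the positive quadrant $[0,\infty)^2$, and let $\{Z_n\}_{n\ge1}$ be i.i.d. positive random variables with finite mean; $\Pi$, $\{Z_n\}$ and the initial value $(X_0,Y_0)\in(-\infty,\infty)\times[0,\infty)$ are independent. The point process $N$ on $(0,\infty)$, with $N(t):=N((0,t])$, is constructed recursively by $$N(t)=\int_{(0,t]}\int_{[0,\infty)}\mathbf 1(z\le\lambda(s-))\,\Pi(ds\times dz),$$ where $$X(t)=X_0+ct-\sum_{n=1}^{N(t)}Z_n,\qquad Y(t)=Y_0e^{-\alpha t}+k\int_{(0,t]}e^{-\alpha(t-s)}\,dN(s),\qquad \lambda(t)=\varphi(X(t))+Y(t).$$ Thus $N$ has stochastic intensity $\lambda(t)$, and $(X(t),Y(t))_{t\ge0}$ is a time-homogeneous Markov process. A stationary version is one whose initial law for $(X_0,Y_0)$ makes $(X(t),Y(t))_{t\ge0}$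 (together with $N$) stationary under time shifts; ergodic means that shift-invariant events have probability $0$ or $1$. *)

theory Defs
  imports "HOL-Probability.Probability"
begin

section \<open>Random measures\<close>

text \<open>The sigma-algebra on all measures over \<open>K\<close> generated by the evaluations
  \<open>m \<mapsto> m(A)\<close>; it is built like \<^const>\<open>subprob_algebra\<close>, without the bound on the mass.\<close>

definition measure_algebra :: "'a measure \<Rightarrow> 'a measure measure" where
  "measure_algebra K =
    (SUP A \<in> sets K. vimage_algebra {m. sets m = sets K} (\<lambda>m. emeasure m A) borel)"

definition poisson_random_measure ::
    "'w measure \<Rightarrow> 'a measure \<Rightarrow> ('w \<Rightarrow> 'a measure) \<Rightarrow> bool" where
  "poisson_random_measure M \<mu> \<Xi> \<longleftrightarrow>
    \<Xi> \<in> measurable M (measure_algebra \<mu>) \<and>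
    (\<forall>A\<in>sets \<mu>. emeasure \<mu> A < \<infinity> \<longrightarrow>
      (\<forall>n::nat. measure M {\<omega>\<in>space M. emeasure (\<Xi> \<omega>) A = of_nat n}
                = exp (- measure \<mu> A) * measure \<mu> A ^ n / fact n)) \<and>
    (\<forall>A\<in>sets \<mu>. emeasure \<mu> A = \<infinity> \<longrightarrow> (AE \<omega> in M. emeasure (\<Xi> \<omega>) A = \<infinity>)) \<and>
    (\<forall>(A :: nat \<Rightarrow> 'a set) n. range A \<subseteq> sets \<mu> \<longrightarrow> disjoint_family A \<longrightarrow>
      prob_space.indep_vars M (\<lambda>_. borel) (\<lambda>i \<omega>. emeasure (\<Xi> \<omega>) (A i)) {..<n})"

definition lebesgue_quadrant :: "(real \<times> real) measure" where
  "lebesgue_quadrant = restrict_space lborel ({0..} \<times> {0..})"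

text \<open>A point process on \<open>(0,\<infinity>)\<close> is a random counting measure on \<open>(0,\<infinity>)\<close>, almost surely
  with finitely many points in each \<open>(0,t]\<close>.\<close>

definition point_process :: "'w measure \<Rightarrow> ('w \<Rightarrow> real measure) \<Rightarrow> bool" where
  "point_process M N \<longleftrightarrow>
    N \<in> measurable M (measure_algebra (restrict_space borel {0<..})) \<and>
    (AE \<omega> in M. \<forall>t>0. \<exists>n::nat. emeasure (N \<omega>) {0<..t} = of_nat n)"


section \<open>The processes, pathwise\<close>

text \<open>Here \<open>\<nu>\<close> is one realisation of \<open>N\<close>, \<open>z\<close> one of the sequence of the \<open>Z\<^sub>n\<close>, and
  \<open>x\<^sub>0\<close>, \<open>y\<^sub>0\<close> are the initial values.\<close>

definition point_count :: "real measure \<Rightarrow> real \<Rightarrow> nat" where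
  "point_count \<nu> t = nat \<lfloor>measure \<nu> {0<..t}\<rfloor>"

definition X_path :: "real \<Rightarrow> real \<Rightarrow> (nat \<Rightarrow> real) \<Rightarrow> real measure \<Rightarrow> real \<Rightarrow> real" where
  "X_path c x\<^sub>0 z \<nu> t = x\<^sub>0 + c * t - (\<Sum>n=1..point_count \<nu> t. z n)"

definition Y_path :: "real \<Rightarrow> real \<Rightarrow> real \<Rightarrow> real measure \<Rightarrow> real \<Rightarrow> real" where
  "Y_path \<alpha> k y\<^sub>0 \<nu> t =
    y\<^sub>0 * exp (- \<alpha> * t) + k * (LINT s:{0<..t}|\<nu>. exp (- \<alpha> * (t - s)))"

definition intensity_path ::
    "real \<Rightarrow> real \<Rightarrow> real \<Rightarrow> (real \<Rightarrow> real) \<Rightarrow> real \<Rightarrow> real \<Rightarrow> (nat \<Rightarrow> real) \<Rightarrow> real measure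
      \<Rightarrow> real \<Rightarrow> real" where
  "intensity_path c \<alpha> k \<phi> x\<^sub>0 y\<^sub>0 z \<nu> t = \<phi> (X_path c x\<^sub>0 z \<nu> t) + Y_path \<alpha> k y\<^sub>0 \<nu> t"


section \<open>The model\<close>

definition admissible_rate :: "(real \<Rightarrow> real) \<Rightarrow> bool" where
  "admissible_rate \<phi> \<longleftrightarrow>
    (\<forall>x. 0 \<le> \<phi> x) \<and> mono \<phi> \<and> (\<phi> \<longlongrightarrow> 0) at_bot \<and> filterlim \<phi> at_top at_top \<and>
    ((\<forall>x. 0 < \<phi> x) \<or> (\<exists>l. (\<forall>x<l. \<phi> x = 0) \<and> strict_mono_on {l..} \<phi>))"

locale self_exciting_model = prob_space M
  for M :: "'w measure" +
  fixes c \<alpha> k :: real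
    and \<phi> :: "real \<Rightarrow> real"
    and \<Xi> :: "'w \<Rightarrow> (real \<times> real) measure"
    and Z :: "nat \<Rightarrow> 'w \<Rightarrow> real"  \<comment> \<open>only the indices \<open>n \<ge> 1\<close> matter\<close>
    and X\<^sub>0 Y\<^sub>0 :: "'w \<Rightarrow> real"
    and N :: "'w \<Rightarrow> real measure"
  assumes constants_pos: "0 < c" "0 < \<alpha>" "0 < k"
    and admissible: "admissible_rate \<phi>"
    and poisson_field: "poisson_random_measure M lebesgue_quadrant \<Xi>"
    and Z_indep: "indep_vars (\<lambda>_. borel) Z {1..}"
    and Z_identically_distributed: "\<And>n. 1 \<le> n \<Longrightarrow> distr M borel (Z n) = distr M borel (Z 1)"
    and Z_pos: "\<And>n. 1 \<le> n \<Longrightarrow> AE \<omega> in M. 0 < Z n \<omega>"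
    and Z_integrable: "\<And>n. 1 \<le> n \<Longrightarrow> integrable M (Z n)"
    and X\<^sub>0_measurable: "random_variable borel X\<^sub>0"
    and Y\<^sub>0_measurable: "random_variable borel Y\<^sub>0"
    and Y\<^sub>0_nonneg: "AE \<omega> in M. 0 \<le> Y\<^sub>0 \<omega>"
    and independence: "indep_sets
          (\<lambda>i. [sets (vimage_algebra (space M) \<Xi> (measure_algebra lebesgue_quadrant)),
                sets (vimage_algebra (space M) (\<lambda>\<omega>. \<lambda>n\<in>{1..}. Z n \<omega>) (PiM {1..} (\<lambda>_. borel))),
                sets (vimage_algebra (space M) (\<lambda>\<omega>. (X\<^sub>0 \<omega>, Y\<^sub>0 \<omega>)) borel)] ! i)
          {..<3}"
    and N_point_process: "point_process M N"
    and N_recursion: "AE \<omega> in M. \<forall>t>0.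
          emeasure (N \<omega>) {0<..t} =
          emeasure (\<Xi> \<omega>) {(s, u). 0 < s \<and> s \<le> t \<and> 0 \<le> u \<and>
            u \<le> Lim (at_left s) (intensity_path c \<alpha> k \<phi> (X\<^sub>0 \<omega>) (Y\<^sub>0 \<omega>) (\<lambda>n. Z n \<omega>) (N \<omega>))}"
begin

definition X :: "real \<Rightarrow> 'w \<Rightarrow> real" where
  "X t \<omega> = X_path c (X\<^sub>0 \<omega>) (\<lambda>n. Z n \<omega>) (N \<omega>) t"

definition Y :: "real \<Rightarrow> 'w \<Rightarrow> real" where
  "Y t \<omega> = Y_path \<alpha> k (Y\<^sub>0 \<omega>) (N \<omega>) t"

definition intensity :: "real \<Rightarrow> 'w \<Rightarrow> real" where
  "intensity t \<omega> = intensity_path c \<alpha> k \<phi> (X\<^sub>0 \<omega>) (Y\<^sub>0 \<omega>) (\<lambda>n. Z n \<omega>) (N \<omega>) t"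

definition path :: "'w \<Rightarrow> real \<Rightarrow> real \<times> real \<times> real" where
  "path \<omega> = (\<lambda>t\<in>{0..}. (X t \<omega>, Y t \<omega>, real (point_count (N \<omega>) t)))"

end


section \<open>Stationarity and ergodicity\<close>

definition path_space :: "(real \<Rightarrow> real \<times> real \<times> real) measure" where
  "path_space = PiM {0..} (\<lambda>_. borel)"

text \<open>The third coordinate is a counting process, so the shift keeps only its increments.\<close>

definition shift ::
    "real \<Rightarrow> (real \<Rightarrow> real \<times> real \<times> real) \<Rightarrow> real \<Rightarrow> real \<times> real \<times> real" where
  "shift s w = (\<lambda>t\<in>{0..}. (fst (w (s + t)), fst (snd (w (s + t))),
                             snd (snd (w (s + t))) - snd (snd (w s))))"

definition stationary_law :: "(real \<Rightarrow> real \<times> real \<times> real) measure \<Rightarrow> bool" where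
  "stationary_law L \<longleftrightarrow> (\<forall>s\<ge>0. distr L path_space (shift s) = L)"

text \<open>Invariance is understood up to null events. On this uncountable product space every event
  depends on countably many time points only, so the events that are invariant without
  exception under all shifts have trivial probability whatever the law, and ergodicity defined
  by them would be void.\<close>

definition ergodic_law :: "(real \<Rightarrow> real \<times> real \<times> real) measure \<Rightarrow> bool" where
  "ergodic_law L \<longleftrightarrow>
    (\<forall>A\<in>sets path_space.
      (\<forall>s\<ge>0. AE w in L. w \<in> A \<longleftrightarrow> shift s w \<in> A) \<longrightarrow> measure L A \<in> {0, 1})"

end

theory Submission
  imports Defs
begin

text \<open>The proof compares two estimates for the probability \<open>p\<^sub>h\<close> of a jump in \<open>(0,h]\<close> as \<open>h \<rightarrow> 0\<close>. No
  compensator or filtration is involved, as only a short interval after time \<open>0\<close> is looked at,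
  on which the path without jumps is an explicit function of the initial values.

  From below: if no jump occurs in \<open>(0,h]\<close>, the intensity stays above
  \<open>exp (- \<alpha> h) (\<phi> (X\<^sub>0) + Y\<^sub>0)\<close>, and the Poisson field has no points below that level
  (\<open>jump_free_void\<close>). The level is independent of the field, so
  \<open>p\<^sub>h \<ge> E[1 - exp (- h exp (- \<alpha> h) (\<phi> (X\<^sub>0) + Y\<^sub>0))]\<close> up to a discretisation error
  (\<open>jump_probability_ge\<close>), and by Fatou's lemma \<open>p\<^sub>h / h\<close> is asymptotically at least the mean
  intensity \<open>\<lambda> = E[\<phi> (X\<^sub>0)] + E[Y\<^sub>0]\<close>.

  From above: \<open>Y\<close> decays at most by \<open>exp (- \<alpha> h)\<close> and gains \<open>k\<close> at a jump. Since its mean is finite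
  and constant in time, \<open>E[Y\<^sub>0] \<ge> exp (- \<alpha> h) (E[Y\<^sub>0] + k p\<^sub>h)\<close>
  (\<open>jump_probability_le\<close>), so \<open>k p\<^sub>h / h\<close> is asymptotically at most \<open>\<alpha> E[Y\<^sub>0]\<close>.

  Together \<open>k \<lambda> \<le> \<alpha> E[Y\<^sub>0]\<close> (\<open>mean_intensity_le\<close>). As \<open>E[Y\<^sub>0] = \<lambda> - E[\<phi> (X\<^sub>0)]\<close>, the claim follows
  once \<open>E[\<phi> (X\<^sub>0)] > 0\<close>. This holds because the field is empty on a large rectangle with positive
  probability (\<open>immigration_pos\<close>): \<open>X\<close> then rises without jumps to a level where \<open>\<phi>\<close> is
  positive.\<close>


section \<open>Random measures\<close>

lemma space_measure_algebra: "space (measure_algebra K) = {m. sets m = sets K}"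
  unfolding measure_algebra_def by (subst space_Sup_eq_UN) (auto simp: image_iff)

lemma measurable_emeasure_measure_algebra:
  "A \<in> sets K \<Longrightarrow> (\<lambda>m. emeasure m A) \<in> borel_measurable (measure_algebra K)"
  unfolding measure_algebra_def
  by (auto intro!: measurable_Sup1 measurable_vimage_algebra1)

lemma measurable_nn_integral_measure_algebra:
  assumes "f \<in> borel_measurable K"
  shows "(\<lambda>m. integral\<^sup>N m f) \<in> borel_measurable (measure_algebra K)" (is "_ \<in> ?B")
  using assms
proof induct
  case (cong f g)
  moreover have "(\<lambda>m. \<integral>\<^sup>+x. f x \<partial>m) \<in> ?B \<longleftrightarrow> (\<lambda>m. \<integral>\<^sup>+x. g x \<partial>m) \<in> ?B"
    by (intro measurable_cong nn_integral_cong cong)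
       (auto simp: space_measure_algebra dest!: sets_eq_imp_space_eq)
  ultimately show ?case by simp
next
  case (set B)
  then have "(\<lambda>m. \<integral>\<^sup>+x. indicator B x \<partial>m) \<in> ?B \<longleftrightarrow> (\<lambda>m. emeasure m B) \<in> ?B"
    by (intro measurable_cong nn_integral_indicator) (simp add: space_measure_algebra)
  with set show ?case
    by (simp add: measurable_emeasure_measure_algebra)
next
  case (mult f c)
  then have "(\<lambda>m. \<integral>\<^sup>+x. c * f x \<partial>m) \<in> ?B \<longleftrightarrow> (\<lambda>m. c * \<integral>\<^sup>+x. f x \<partial>m) \<in> ?B"
    by (intro measurable_cong nn_integral_cmult) (auto simp: space_measure_algebra)
  with mult show ?case
    by simp
next
  case (add f g)
  then have "(\<lambda>m. \<integral>\<^sup>+x. f x + g x \<partial>m) \<in> ?B \<longleftrightarrow>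
      (\<lambda>m. (\<integral>\<^sup>+x. f x \<partial>m) + (\<integral>\<^sup>+x. g x \<partial>m)) \<in> ?B"
    by (intro measurable_cong nn_integral_add) (auto simp: space_measure_algebra)
  with add show ?case
    by (simp add: ac_simps)
next
  case (seq F)
  then have "(\<lambda>m. \<integral>\<^sup>+x. (SUP i. F i) x \<partial>m) \<in> ?B \<longleftrightarrow> (\<lambda>m. SUP i. (\<integral>\<^sup>+x. F i x \<partial>m)) \<in> ?B"
    unfolding SUP_apply
    by (intro measurable_cong nn_integral_monotone_convergence_SUP)
       (auto simp: space_measure_algebra)
  with seq show ?case
    by (simp add: ac_simps)
qed

lemma poisson_void_probability:
  assumes "poisson_random_measure M \<mu> \<Xi>" "A \<in> sets \<mu>" "emeasure \<mu> A < \<infinity>"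
  shows "measure M {\<omega>\<in>space M. emeasure (\<Xi> \<omega>) A = 0} = exp (- measure \<mu> A)"
proof -
  have "measure M {\<omega>\<in>space M. emeasure (\<Xi> \<omega>) A = of_nat 0} =
      exp (- measure \<mu> A) * measure \<mu> A ^ 0 / fact 0"
    using assms unfolding poisson_random_measure_def by blast
  then show ?thesis by simp
qed

abbreviation strip :: "real \<Rightarrow> real \<Rightarrow> (real \<times> real) set" where
  "strip h w \<equiv> {0<..h} \<times> {0..w}"

lemma sets_lebesgue_quadrant_iff:
  "A \<in> sets lebesgue_quadrant \<longleftrightarrow> A \<subseteq> {0..} \<times> {0..} \<and> A \<in> sets borel"
  unfolding lebesgue_quadrant_def
  by (subst sets_restrict_space_iff) (auto simp: borel_prod[symmetric])

lemma strip_sets: "strip h w \<in> sets lebesgue_quadrant"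
  unfolding sets_lebesgue_quadrant_iff by (auto simp: borel_prod[symmetric])

lemma emeasure_strip:
  assumes "0 \<le> h" "0 \<le> w"
  shows "emeasure lebesgue_quadrant (strip h w) = ennreal (h * w)"
proof -
  have "emeasure lebesgue_quadrant (strip h w) = emeasure (lborel :: (real \<times> real) measure) (strip h w)"
    unfolding lebesgue_quadrant_def
    by (intro emeasure_restrict_space) (auto simp: borel_prod[symmetric])
  also have "\<dots> = emeasure (lborel \<Otimes>\<^sub>M lborel) (strip h w)"
    by (simp add: lborel_prod)
  also have "\<dots> = emeasure lborel {0<..h} * emeasure lborel {0..w}"
    by (intro lborel.emeasure_pair_measure_Times) auto
  also have "\<dots> = ennreal (h * w)"
    using assms by (simp add: ennreal_mult)
  finally show ?thesis .
qed


section \<open>Paths without jumps\<close>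

lemma mono_tendsto_at_left_SUP:
  fixes f :: "real \<Rightarrow> real"
  assumes "mono f"
  shows "(f \<longlongrightarrow> (SUP r\<in>{..<s}. f r)) (at_left s)"
proof (rule increasing_tendsto)
  have bdd: "bdd_above (f ` {..<s})"
    by (intro bdd_aboveI[of _ "f s"]) (auto intro!: monoD[OF assms])
  show "\<forall>\<^sub>F r in at_left s. f r \<le> (SUP r\<in>{..<s}. f r)"
    unfolding eventually_at_left_field
    by (intro exI[of _ "s - 1"]) (auto intro!: cSUP_upper bdd)
  fix y assume "y < (SUP r\<in>{..<s}. f r)"
  then obtain r where r: "r < s" "y < f r"
    using less_cSUP_iff[OF _ bdd, of y] by auto
  show "\<forall>\<^sub>F q in at_left s. y < f q"
    unfolding eventually_at_left_field
    using r by (intro exI[of _ r]) (auto intro: less_le_trans[OF _ monoD[OF assms]])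
qed

lemma X_path_jump_free:
  assumes "emeasure \<nu> {0<..s} = 0"
  shows "X_path c x\<^sub>0 z \<nu> s = x\<^sub>0 + c * s"
  using assms by (simp add: X_path_def point_count_def measure_def)

lemma Y_path_jump_free:
  assumes \<nu>: "sets \<nu> = sets (restrict_space borel {0<..})" and "emeasure \<nu> {0<..s} = 0"
  shows "Y_path \<alpha> k y\<^sub>0 \<nu> s = y\<^sub>0 * exp (- \<alpha> * s)"
proof -
  have "{0<..s} \<in> sets \<nu>"
    unfolding \<nu> by (subst sets_restrict_space_iff) auto
  then have "{0<..s} \<in> null_sets \<nu>"
    using assms by auto
  then have "(LINT r:{0<..s}|\<nu>. exp (- \<alpha> * (s - r))) = 0"
    unfolding set_lebesgue_integral_def
    by (intro integral_eq_zero_AE) (auto dest!: AE_not_in elim!: eventually_mono)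
  then show ?thesis by (simp add: Y_path_def)
qed

text \<open>Since \<open>\<phi>\<close> may be discontinuous, its left limit is kept as a supremum. Only the stretch strictly
  before \<open>s\<close> has to be free of jumps, so that the first jump time is covered.\<close>

lemma left_intensity_jump_free:
  assumes \<nu>: "sets \<nu> = sets (restrict_space borel {0<..})"
    and free: "\<And>r. 0 < r \<Longrightarrow> r < s \<Longrightarrow> emeasure \<nu> {0<..r} = 0"
    and s: "0 < s" and c: "0 \<le> c" and \<phi>: "mono \<phi>"
  shows "Lim (at_left s) (intensity_path c \<alpha> k \<phi> x\<^sub>0 y\<^sub>0 z \<nu>) =
    (SUP r\<in>{..<s}. \<phi> (x\<^sub>0 + c * r)) + y\<^sub>0 * exp (- \<alpha> * s)"
proof (rule tendsto_Lim)
  have "mono (\<lambda>r. \<phi> (x\<^sub>0 + c * r))"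
    using c by (intro monoI monoD[OF \<phi>] add_left_mono mult_left_mono)
  from mono_tendsto_at_left_SUP[OF this, of s]
  have "((\<lambda>r. \<phi> (x\<^sub>0 + c * r) + y\<^sub>0 * exp (- \<alpha> * r)) \<longlongrightarrow>
      (SUP r\<in>{..<s}. \<phi> (x\<^sub>0 + c * r)) + y\<^sub>0 * exp (- \<alpha> * s)) (at_left s)"
    by (intro tendsto_intros)
  moreover have "\<forall>\<^sub>F r in at_left s. \<phi> (x\<^sub>0 + c * r) + y\<^sub>0 * exp (- \<alpha> * r) =
      intensity_path c \<alpha> k \<phi> x\<^sub>0 y\<^sub>0 z \<nu> r"
    unfolding eventually_at_left_field using s
    by (intro exI[of _ 0])
       (auto simp: intensity_path_def X_path_jump_free free Y_path_jump_free[OF \<nu>])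
  ultimately show "(intensity_path c \<alpha> k \<phi> x\<^sub>0 y\<^sub>0 z \<nu> \<longlongrightarrow>
      (SUP r\<in>{..<s}. \<phi> (x\<^sub>0 + c * r)) + y\<^sub>0 * exp (- \<alpha> * s)) (at_left s)"
    by (rule Lim_transform_eventually)
qed simp

lemma SUP_left_bounds:
  fixes \<phi> :: "real \<Rightarrow> real"
  assumes \<phi>: "mono \<phi>" and c: "0 \<le> c" and s: "0 < s"
  shows "\<phi> x \<le> (SUP r\<in>{..<s}. \<phi> (x + c * r))"
    and "(SUP r\<in>{..<s}. \<phi> (x + c * r)) \<le> \<phi> (x + c * s)"
proof -
  have le: "\<phi> (x + c * r) \<le> \<phi> (x + c * s)" if "r < s" for r
    using that c by (intro monoD[OF \<phi>] add_left_mono mult_left_mono) auto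
  then have bdd: "bdd_above ((\<lambda>r. \<phi> (x + c * r)) ` {..<s})"
    by (intro bdd_aboveI[of _ "\<phi> (x + c * s)"]) auto
  show "\<phi> x \<le> (SUP r\<in>{..<s}. \<phi> (x + c * r))"
    using cSUP_upper[OF _ bdd, of 0] s by simp
  show "(SUP r\<in>{..<s}. \<phi> (x + c * r)) \<le> \<phi> (x + c * s)"
    using le by (intro cSUP_least) auto
qed

lemma mono_SUP_left:
  fixes \<phi> :: "real \<Rightarrow> real"
  assumes \<phi>: "mono \<phi>" and c: "0 \<le> c"
  shows "mono (\<lambda>s. SUP r\<in>{..<s}. \<phi> (x + c * r))"
proof (rule monoI)
  fix s s' :: real assume "s \<le> s'"
  have "\<phi> (x + c * r) \<le> \<phi> (x + c * s')" if "r < s'" for r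
    using that c by (intro monoD[OF \<phi>] add_left_mono mult_left_mono) auto
  then have "bdd_above ((\<lambda>r. \<phi> (x + c * r)) ` {..<s'})"
    by (intro bdd_aboveI[of _ "\<phi> (x + c * s')"]) auto
  then show "(SUP r\<in>{..<s}. \<phi> (x + c * r)) \<le> (SUP r\<in>{..<s'}. \<phi> (x + c * r))"
    using \<open>s \<le> s'\<close> by (intro cSUP_subset_mono) auto
qed


section \<open>Measurability and stationarity of the model\<close>

context self_exciting_model
begin

lemma \<phi>_nonneg: "0 \<le> \<phi> x" and mono_\<phi>: "mono \<phi>"
  using admissible unfolding admissible_rate_def by auto

lemma \<phi>_measurable [measurable]: "\<phi> \<in> borel_measurable borel"
  by (rule borel_measurable_mono[OF mono_\<phi>])

declare X\<^sub>0_measurable [measurable] Y\<^sub>0_measurable [measurable]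

lemma N_measurable: "N \<in> measurable M (measure_algebra (restrict_space borel {0<..}))"
  using N_point_process unfolding point_process_def by simp

lemma \<Xi>_measurable: "\<Xi> \<in> measurable M (measure_algebra lebesgue_quadrant)"
  using poisson_field unfolding poisson_random_measure_def by simp

lemma sets_N: "\<omega> \<in> space M \<Longrightarrow> sets (N \<omega>) = sets (restrict_space borel {0<..})"
  using measurable_space[OF N_measurable] by (simp add: space_measure_algebra)

lemma sets_\<Xi>: "\<omega> \<in> space M \<Longrightarrow> sets (\<Xi> \<omega>) = sets lebesgue_quadrant"
  using measurable_space[OF \<Xi>_measurable] by (simp add: space_measure_algebra)

lemma Ioc_sets: "{0<..t} \<in> sets (restrict_space borel {0::real<..})"
  by (subst sets_restrict_space_iff) auto

lemma emeasure_N_measurable [measurable]: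
  "(\<lambda>\<omega>. emeasure (N \<omega>) {0<..t}) \<in> borel_measurable M"
  by (rule measurable_compose[OF N_measurable measurable_emeasure_measure_algebra[OF Ioc_sets]])

lemma emeasure_\<Xi>_measurable [measurable]:
  "(\<lambda>\<omega>. emeasure (\<Xi> \<omega>) (strip h w)) \<in> borel_measurable M"
  by (rule measurable_compose[OF \<Xi>_measurable measurable_emeasure_measure_algebra[OF strip_sets]])

lemma Z_measurable: "1 \<le> n \<Longrightarrow> Z n \<in> borel_measurable M"
  using Z_indep unfolding indep_vars_def by auto

lemma point_count_measurable [measurable]:
  "(\<lambda>\<omega>. point_count (N \<omega>) t) \<in> measurable M (count_space UNIV)"
  unfolding point_count_def Sigma_Algebra.measure_def by measurable

lemma X_measurable [measurable]: "X t \<in> borel_measurable M"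
proof -
  have "(\<lambda>\<omega>. (\<lambda>m \<omega>. \<Sum>n=1..m. Z n \<omega>) (point_count (N \<omega>) t) \<omega>) \<in> borel_measurable M"
    by (rule measurable_compose_countable) (auto intro!: borel_measurable_sum Z_measurable)
  then show ?thesis
    unfolding X_def X_path_def by measurable
qed

text \<open>The integral in the definition of \<open>Y\<close> is a Bochner integral. Rewriting it as a nonnegative
  integral, with \<open>enn2real\<close> matching the value \<open>0\<close> that both assign on paths with infinitely many
  points, gives measurability on the whole of \<open>M\<close> and not only up to a null set.\<close>

lemma Y_measurable [measurable]: "Y t \<in> borel_measurable M"
proof -
  define f where "f r = ennreal (indicator {0<..t} r * exp (- \<alpha> * (t - r)))" for r
  have f: "f \<in> borel_measurable (restrict_space borel {0<..})"
    unfolding f_def by (intro measurable_restrict_space1) measurable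
  have int: "(\<lambda>\<omega>. Y\<^sub>0 \<omega> * exp (- \<alpha> * t) + k * enn2real (\<integral>\<^sup>+r. f r \<partial>N \<omega>)) \<in> borel_measurable M"
    using measurable_compose[OF N_measurable measurable_nn_integral_measure_algebra[OF f]]
    by measurable
  have eq: "Y t \<omega> = Y\<^sub>0 \<omega> * exp (- \<alpha> * t) + k * enn2real (\<integral>\<^sup>+r. f r \<partial>N \<omega>)"
    if "\<omega> \<in> space M" for \<omega>
  proof -
    have "(\<lambda>r. indicator {0<..t} r *\<^sub>R exp (- \<alpha> * (t - r))) \<in> borel_measurable (N \<omega>)"
      unfolding measurable_cong_sets[OF sets_N[OF that] refl]
      by (intro measurable_restrict_space1) measurable
    then show ?thesis
      unfolding Y_def Y_path_def set_lebesgue_integral_def f_def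
      by (subst integral_eq_nn_integral) auto
  qed
  show ?thesis
    using int by (rule measurable_cong[THEN iffD2, rotated]) (rule eq)
qed

lemma X_0: "X 0 \<omega> = X\<^sub>0 \<omega>" and Y_0: "Y 0 \<omega> = Y\<^sub>0 \<omega>"
  by (simp_all add: X_def X_path_def Y_def Y_path_def point_count_def set_lebesgue_integral_def)

text \<open>The \<open>distr\<close> of a function that is not measurable is no image measure; stationarity speaks about
  the processes only through this fact.\<close>

lemma path_measurable: "path \<in> measurable M path_space"
proof -
  have "(\<lambda>\<omega>. (X t \<omega>, Y t \<omega>, real (point_count (N \<omega>) t))) \<in> borel_measurable M" for t
    by (intro borel_measurable_Pair) measurable
  then show ?thesis
    unfolding path_def path_space_def by (intro measurable_restrict) auto
qed

lemma shift_measurable: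
  assumes "0 \<le> s"
  shows "shift s \<in> measurable path_space path_space"
proof -
  have ev: "(\<lambda>w. w t) \<in> measurable path_space (borel :: (real \<times> real \<times> real) measure)"
    if "0 \<le> t" for t
    unfolding path_space_def using that by (intro measurable_component_singleton) auto
  have [measurable]: "(\<lambda>w. fst (w t)) \<in> borel_measurable path_space"
      "(\<lambda>w. fst (snd (w t))) \<in> borel_measurable path_space"
      "(\<lambda>w. snd (snd (w t))) \<in> borel_measurable path_space" if "0 \<le> t" for t
    using ev[OF that] unfolding borel_prod[symmetric] by measurable
  have "(\<lambda>w. (fst (w (s + t)), fst (snd (w (s + t))), snd (snd (w (s + t))) - snd (snd (w s))))
      \<in> borel_measurable path_space" if "0 \<le> t" for t
    using assms that by (intro borel_measurable_Pair) auto
  then show ?thesis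
    unfolding shift_def by (subst (2) path_space_def, intro measurable_restrict) auto
qed

lemma stationary_nn_integral:
  fixes g :: "real \<times> real \<Rightarrow> ennreal"
  assumes stat: "stationary_law (distr M path_space path)" and s: "0 \<le> s"
    and [measurable]: "g \<in> borel_measurable borel"
  shows "(\<integral>\<^sup>+\<omega>. g (X s \<omega>, Y s \<omega>) \<partial>M) = (\<integral>\<^sup>+\<omega>. g (X\<^sub>0 \<omega>, Y\<^sub>0 \<omega>) \<partial>M)"
proof -
  define G where "G w = g (fst (w 0), fst (snd (w 0)))" for w :: "real \<Rightarrow> real \<times> real \<times> real"
  let ?L = "distr M path_space path"
  have ev: "(\<lambda>w. w 0) \<in> measurable path_space (borel :: (real \<times> real \<times> real) measure)"
    unfolding path_space_def by (intro measurable_component_singleton) auto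
  have G: "G \<in> borel_measurable path_space"
  proof -
    have [measurable]: "(\<lambda>w. fst (w 0)) \<in> borel_measurable path_space"
      "(\<lambda>w. fst (snd (w 0))) \<in> borel_measurable path_space"
      using ev unfolding borel_prod[symmetric] by measurable
    show ?thesis
      unfolding G_def by measurable
  qed
  have "(\<integral>\<^sup>+\<omega>. g (X s \<omega>, Y s \<omega>) \<partial>M) = (\<integral>\<^sup>+\<omega>. G (shift s (path \<omega>)) \<partial>M)"
    using s by (simp add: G_def shift_def path_def)
  also have "\<dots> = (\<integral>\<^sup>+w. G (shift s w) \<partial>?L)"
    using G shift_measurable[OF s] path_measurable by (subst nn_integral_distr) auto
  also have "\<dots> = (\<integral>\<^sup>+w. G w \<partial>distr ?L path_space (shift s))"
    using G shift_measurable[OF s] by (subst nn_integral_distr) auto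
  also have "\<dots> = (\<integral>\<^sup>+w. G w \<partial>?L)"
    using stat s by (simp add: stationary_law_def)
  also have "\<dots> = (\<integral>\<^sup>+\<omega>. G (path \<omega>) \<partial>M)"
    using G path_measurable by (subst nn_integral_distr) auto
  also have "\<dots> = (\<integral>\<^sup>+\<omega>. g (X\<^sub>0 \<omega>, Y\<^sub>0 \<omega>) \<partial>M)"
    by (simp add: G_def path_def X_0 Y_0)
  finally show ?thesis .
qed

lemma N_finite: "AE \<omega> in M. \<forall>t>0. \<exists>n::nat. emeasure (N \<omega>) {0<..t} = of_nat n"
  using N_point_process unfolding point_process_def by simp


section \<open>Jumps and points of the Poisson field\<close>

text \<open>Without a jump up to \<open>h\<close>, the left limit of the intensity on \<open>(0,h]\<close> is at least
  \<open>exp (- \<alpha> h) (\<phi> (X\<^sub>0) + Y\<^sub>0)\<close>, because the drift is upwards. The region below the intensity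
  then contains a strip, which depends on the initial values only; this is what makes the
  independence of field and initial values applicable without any adaptedness of \<open>N\<close>.\<close>

lemma jump_free_void:
  "AE \<omega> in M. \<forall>h>0. emeasure (N \<omega>) {0<..h} = 0 \<longrightarrow>
    (\<forall>w \<le> exp (- \<alpha> * h) * (\<phi> (X\<^sub>0 \<omega>) + Y\<^sub>0 \<omega>). emeasure (\<Xi> \<omega>) (strip h w) = 0)"
  using N_recursion Y\<^sub>0_nonneg AE_space
proof eventually_elim
  case (elim \<omega>)
  show ?case
  proof (intro allI impI)
    fix h w :: real
    assume h: "0 < h" and free: "emeasure (N \<omega>) {0<..h} = 0"
      and w: "w \<le> exp (- \<alpha> * h) * (\<phi> (X\<^sub>0 \<omega>) + Y\<^sub>0 \<omega>)"
    define g where "g s = (SUP r\<in>{..<s}. \<phi> (X\<^sub>0 \<omega> + c * r)) + Y\<^sub>0 \<omega> * exp (- \<alpha> * s)" for s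
    define S where "S = {(s, u). 0 < s \<and> s \<le> h \<and> 0 \<le> u \<and> u \<le> g s}"
    have [measurable]: "(\<lambda>s. SUP r\<in>{..<s}. \<phi> (X\<^sub>0 \<omega> + c * r)) \<in> borel_measurable borel"
      using constants_pos by (intro borel_measurable_mono mono_SUP_left mono_\<phi>) auto
    have [measurable]: "g \<in> borel_measurable borel"
      unfolding g_def by measurable
    have free': "emeasure (N \<omega>) {0<..r} = 0" if "r < h" for r
    proof -
      have "emeasure (N \<omega>) {0<..r} \<le> emeasure (N \<omega>) {0<..h}"
        using that Ioc_sets sets_N[OF elim(3)] by (intro emeasure_mono) auto
      then show ?thesis using free by simp
    qed
    have lim: "Lim (at_left s) (intensity_path c \<alpha> k \<phi> (X\<^sub>0 \<omega>) (Y\<^sub>0 \<omega>) (\<lambda>n. Z n \<omega>) (N \<omega>)) = g s"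
      if "0 < s" "s \<le> h" for s
      unfolding g_def using that free' constants_pos
      by (intro left_intensity_jump_free sets_N elim mono_\<phi>) auto
    have "{(s, u). 0 < s \<and> s \<le> h \<and> 0 \<le> u \<and>
        u \<le> Lim (at_left s) (intensity_path c \<alpha> k \<phi> (X\<^sub>0 \<omega>) (Y\<^sub>0 \<omega>) (\<lambda>n. Z n \<omega>) (N \<omega>))} = S"
      unfolding S_def using lim by auto
    then have "emeasure (\<Xi> \<omega>) S = 0"
      using elim(1) h free by simp
    moreover have "S \<in> sets (\<Xi> \<omega>)"
    proof -
      have "S = {p \<in> space (borel \<Otimes>\<^sub>M borel). 0 < fst p \<and> fst p \<le> h \<and> 0 \<le> snd p \<and> snd p \<le> g (fst p)}"
        by (auto simp: S_def space_pair_measure)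
      also have "\<dots> \<in> sets (borel \<Otimes>\<^sub>M borel)"
        by measurable
      finally have "S \<in> sets borel"
        unfolding borel_prod .
      then show ?thesis
        unfolding sets_\<Xi>[OF elim(3)] sets_lebesgue_quadrant_iff
        by (auto simp: S_def)
    qed
    moreover have "strip h w \<subseteq> S"
    proof -
      have "w \<le> g s" if s: "0 < s" "s \<le> h" for s
      proof -
        have "w \<le> exp (- \<alpha> * h) * \<phi> (X\<^sub>0 \<omega>) + Y\<^sub>0 \<omega> * exp (- \<alpha> * h)"
          using w by (simp add: algebra_simps)
        also have "exp (- \<alpha> * h) * \<phi> (X\<^sub>0 \<omega>) \<le> 1 * \<phi> (X\<^sub>0 \<omega>)"
          using constants_pos h \<phi>_nonneg by (intro mult_right_mono) auto
        also have "1 * \<phi> (X\<^sub>0 \<omega>) \<le> (SUP r\<in>{..<s}. \<phi> (X\<^sub>0 \<omega> + c * r))"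
          using SUP_left_bounds(1)[OF mono_\<phi> _ s(1)] constants_pos by simp
        also have "Y\<^sub>0 \<omega> * exp (- \<alpha> * h) \<le> Y\<^sub>0 \<omega> * exp (- \<alpha> * s)"
          using elim(2) s constants_pos by (intro mult_left_mono) auto
        finally show ?thesis
          by (simp add: g_def)
      qed
      then show ?thesis
        unfolding S_def by fastforce
    qed
    ultimately show "emeasure (\<Xi> \<omega>) (strip h w) = 0"
      by (metis emeasure_mono le_zero_eq)
  qed
qed

text \<open>Up to and including the first jump time \<open>\<tau>\<close>, the left limits of the intensity are still those
  of the jump-free path, hence at most \<open>K\<close>; the first jump would therefore need a point of the
  field in the empty strip.\<close>

lemma void_jump_free:
  "AE \<omega> in M. \<forall>t>0. \<forall>K \<ge> \<phi> (X\<^sub>0 \<omega> + c * t) + Y\<^sub>0 \<omega>.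
    emeasure (\<Xi> \<omega>) (strip t K) = 0 \<longrightarrow> emeasure (N \<omega>) {0<..t} = 0"
  using N_recursion Y\<^sub>0_nonneg N_finite AE_space
proof eventually_elim
  case (elim \<omega>)
  show ?case
  proof (intro allI impI, rule ccontr)
    fix t K :: real
    assume t: "0 < t" and K: "\<phi> (X\<^sub>0 \<omega> + c * t) + Y\<^sub>0 \<omega> \<le> K"
      and void: "emeasure (\<Xi> \<omega>) (strip t K) = 0" and jump: "emeasure (N \<omega>) {0<..t} \<noteq> 0"
    have Ioc: "{0<..s} \<in> sets (N \<omega>)" for s
      using Ioc_sets sets_N[OF elim(4)] by auto
    define J where "J = {s. 0 < s \<and> emeasure (N \<omega>) {0<..s} \<noteq> 0}"
    define \<tau> where "\<tau> = Inf J"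
    have J: "t \<in> J" "bdd_below J"
      using t jump by (auto simp: J_def intro!: bdd_belowI[of _ 0])
    have \<tau>: "0 \<le> \<tau>" "\<tau> \<le> t"
      unfolding \<tau>_def using J by (auto intro!: cInf_greatest cInf_lower simp: J_def)
    have before: "emeasure (N \<omega>) {0<..r} = 0" if "0 < r" "r < \<tau>" for r
      using that cInf_lower[OF _ J(2), of r] by (fastforce simp: \<tau>_def J_def)
    \<comment> \<open>there is a jump at \<open>\<tau>\<close> itself, since \<open>N\<close> is integer-valued and right-continuous; in
        particular \<open>\<tau> > 0\<close>\<close>
    have after: "1 \<le> emeasure (N \<omega>) {0<..\<tau> + 1 / real (Suc n)}" for n
    proof -
      obtain s where s: "s \<in> J" "s < \<tau> + 1 / real (Suc n)"
        using cInf_lessD[of J "\<tau> + 1 / real (Suc n)"] J by (auto simp: \<tau>_def)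
      obtain m :: nat where "emeasure (N \<omega>) {0<..s} = of_nat m" "m \<noteq> 0"
        using elim(3) s(1) by (auto simp: J_def)
      then have "1 \<le> emeasure (N \<omega>) {0<..s}"
        by simp
      also have "\<dots> \<le> emeasure (N \<omega>) {0<..\<tau> + 1 / real (Suc n)}"
        using s(2) Ioc by (intro emeasure_mono) auto
      finally show ?thesis .
    qed
    have "(\<lambda>n. emeasure (N \<omega>) {0<..\<tau> + 1 / real (Suc n)}) \<longlonglongrightarrow>
        emeasure (N \<omega>) (\<Inter>n. {0<..\<tau> + 1 / real (Suc n)})"
    proof (rule Lim_emeasure_decseq)
      show "decseq (\<lambda>n. {0<..\<tau> + 1 / real (Suc n)})"
      proof (rule decseq_SucI)
        fix n
        have "1 / real (Suc (Suc n)) \<le> 1 / real (Suc n)"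
          by (intro divide_left_mono) auto
        then have "\<tau> + 1 / real (Suc (Suc n)) \<le> \<tau> + 1 / real (Suc n)"
          by (rule add_left_mono)
        then show "{0<..\<tau> + 1 / real (Suc (Suc n))} \<subseteq> {0<..\<tau> + 1 / real (Suc n)}"
          by auto
      qed
      fix n
      have "0 < \<tau> + 1 / real (Suc n)"
        using \<tau> by (intro add_nonneg_pos) auto
      then obtain m :: nat where "emeasure (N \<omega>) {0<..\<tau> + 1 / real (Suc n)} = of_nat m"
        using elim(3) by blast
      then show "emeasure (N \<omega>) {0<..\<tau> + 1 / real (Suc n)} \<noteq> \<infinity>"
        by simp
    qed (use Ioc in auto)
    also have "(\<Inter>n. {0<..\<tau> + 1 / real (Suc n)}) = {0<..\<tau>}"
    proof (intro equalityI subsetI)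
      fix r assume r: "r \<in> (\<Inter>n. {0<..\<tau> + 1 / real (Suc n)})"
      have "(\<lambda>n. \<tau> + 1 / real (Suc n)) \<longlonglongrightarrow> \<tau> + 0"
        by (intro tendsto_intros LIMSEQ_Suc[OF lim_1_over_n])
      then have "r \<le> \<tau> + 0"
        by (rule LIMSEQ_le_const) (use r in auto)
      then show "r \<in> {0<..\<tau>}"
        using r by auto
    qed (auto intro: add_increasing2)
    finally have at: "1 \<le> emeasure (N \<omega>) {0<..\<tau>}"
      by (rule LIMSEQ_le_const) (use after in auto)
    then have \<tau>_pos: "0 < \<tau>"
      using \<tau> by (cases "\<tau> = 0") auto
    have "emeasure (N \<omega>) {0<..\<tau>} = emeasure (\<Xi> \<omega>) {(s, u). 0 < s \<and> s \<le> \<tau> \<and> 0 \<le> u \<and>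
        u \<le> Lim (at_left s) (intensity_path c \<alpha> k \<phi> (X\<^sub>0 \<omega>) (Y\<^sub>0 \<omega>) (\<lambda>n. Z n \<omega>) (N \<omega>))}"
      using elim(1) \<tau>_pos by blast
    also have "\<dots> \<le> emeasure (\<Xi> \<omega>) (strip t K)"
    proof (rule emeasure_mono)
      have "Lim (at_left s) (intensity_path c \<alpha> k \<phi> (X\<^sub>0 \<omega>) (Y\<^sub>0 \<omega>) (\<lambda>n. Z n \<omega>) (N \<omega>)) \<le> K"
        if s: "0 < s" "s \<le> \<tau>" for s
      proof -
        have "Lim (at_left s) (intensity_path c \<alpha> k \<phi> (X\<^sub>0 \<omega>) (Y\<^sub>0 \<omega>) (\<lambda>n. Z n \<omega>) (N \<omega>)) =
            (SUP r\<in>{..<s}. \<phi> (X\<^sub>0 \<omega> + c * r)) + Y\<^sub>0 \<omega> * exp (- \<alpha> * s)"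
          using s before constants_pos by (intro left_intensity_jump_free sets_N elim mono_\<phi>) auto
        also have "(SUP r\<in>{..<s}. \<phi> (X\<^sub>0 \<omega> + c * r)) \<le> \<phi> (X\<^sub>0 \<omega> + c * s)"
          using SUP_left_bounds(2)[OF mono_\<phi> _ s(1)] constants_pos by simp
        also have "\<phi> (X\<^sub>0 \<omega> + c * s) \<le> \<phi> (X\<^sub>0 \<omega> + c * t)"
          using s \<tau> constants_pos by (intro monoD[OF mono_\<phi>] add_left_mono mult_left_mono) auto
        also have "Y\<^sub>0 \<omega> * exp (- \<alpha> * s) \<le> Y\<^sub>0 \<omega> * 1"
          using elim(2) s constants_pos by (intro mult_left_mono) auto
        finally show ?thesis
          using K by simp
      qed
      then show "{(s, u). 0 < s \<and> s \<le> \<tau> \<and> 0 \<le> u \<and>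
          u \<le> Lim (at_left s) (intensity_path c \<alpha> k \<phi> (X\<^sub>0 \<omega>) (Y\<^sub>0 \<omega>) (\<lambda>n. Z n \<omega>) (N \<omega>))}
          \<subseteq> strip t K"
        using \<tau> by fastforce
      show "strip t K \<in> sets (\<Xi> \<omega>)"
        using strip_sets sets_\<Xi>[OF elim(4)] by simp
    qed
    finally show False
      using void at by simp
  qed
qed

lemma prob_void_Int:
  assumes h: "0 \<le> h" and w: "0 \<le> w" and B: "B \<in> sets borel"
  shows "prob ({\<omega>\<in>space M. emeasure (\<Xi> \<omega>) (strip h w) = 0} \<inter> {\<omega>\<in>space M. (X\<^sub>0 \<omega>, Y\<^sub>0 \<omega>) \<in> B}) =
    exp (- (h * w)) * prob {\<omega>\<in>space M. (X\<^sub>0 \<omega>, Y\<^sub>0 \<omega>) \<in> B}"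
    (is "prob (?E \<inter> ?F) = _")
proof -
  let ?MA = "measure_algebra lebesgue_quadrant"
  have "{m \<in> space ?MA. emeasure m (strip h w) = 0} \<in> sets ?MA"
    using measurable_emeasure_measure_algebra[OF strip_sets[of h w]] by measurable
  from in_vimage_algebra[OF this, of \<Xi> "space M"]
  have E: "?E \<in> sets (vimage_algebra (space M) \<Xi> ?MA)"
    using measurable_space[OF \<Xi>_measurable]
    by (auto elim!: back_subst[where P="\<lambda>A. A \<in> _"])
  from in_vimage_algebra[OF B, of "\<lambda>\<omega>. (X\<^sub>0 \<omega>, Y\<^sub>0 \<omega>)" "space M"]
  have F: "?F \<in> sets (vimage_algebra (space M) (\<lambda>\<omega>. (X\<^sub>0 \<omega>, Y\<^sub>0 \<omega>)) borel)"
    by (auto elim!: back_subst[where P="\<lambda>A. A \<in> _"])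
  have "prob (?E \<inter> ?F) = prob ?E * prob ?F"
    using indep_setsD[OF independence, of "{0, 2}" "\<lambda>i. if i = 0 then ?E else ?F"] E F
    by (simp add: Int_commute)
  also have "prob ?E = exp (- (h * w))"
    using poisson_void_probability[OF poisson_field strip_sets, of h w] h w
    by (simp add: emeasure_strip Sigma_Algebra.measure_def)
  finally show ?thesis .
qed


section \<open>The two estimates for the probability of a jump\<close>

text \<open>The function \<open>j\<close> discretises the random level to multiples of \<open>h\<close>: for each of the countably many
  values the void probability of a deterministic strip applies, and independence of the field
  from the initial values puts the pieces together. This replaces conditioning on
  \<open>(X\<^sub>0, Y\<^sub>0)\<close>.\<close>

lemma jump_free_probability_le:
  assumes h: "0 < h"
    and j: "j \<in> measurable borel (count_space UNIV)"
    and le: "\<And>x y. 0 \<le> y \<Longrightarrow> h * real (j (x, y)) \<le> exp (- \<alpha> * h) * (\<phi> x + y)"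
  shows "prob {\<omega>\<in>space M. emeasure (N \<omega>) {0<..h} = 0} \<le>
    (\<integral>\<omega>. exp (- (h * (h * real (j (X\<^sub>0 \<omega>, Y\<^sub>0 \<omega>))))) \<partial>M)"
proof -
  define F where "F i = {\<omega>\<in>space M. (X\<^sub>0 \<omega>, Y\<^sub>0 \<omega>) \<in> j -` {i :: nat}}" for i
  define E where "E i = {\<omega>\<in>space M. emeasure (\<Xi> \<omega>) (strip h (h * real i)) = 0} \<inter> F i" for i
  have jB: "j -` {i} \<in> sets borel" for i
    using measurable_sets[OF j, of "{i}"] by simp
  have pair [measurable]: "(\<lambda>\<omega>. (X\<^sub>0 \<omega>, Y\<^sub>0 \<omega>)) \<in> borel_measurable M"
    by (intro borel_measurable_Pair) measurable
  have F [measurable]: "F i \<in> events" for i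
    unfolding F_def using measurable_sets[OF pair jB[of i]] by (simp add: vimage_def Int_def conj_commute)
  have E [measurable]: "E i \<in> events" for i
    unfolding E_def by measurable
  have [measurable]: "(\<lambda>\<omega>. j (X\<^sub>0 \<omega>, Y\<^sub>0 \<omega>)) \<in> measurable M (count_space UNIV)"
    by (rule measurable_compose[OF pair j])
  have "emeasure M {\<omega>\<in>space M. emeasure (N \<omega>) {0<..h} = 0} \<le> emeasure M (\<Union>i. E i)"
  proof (rule emeasure_mono_AE)
    show "AE \<omega> in M. \<omega> \<in> {\<omega>\<in>space M. emeasure (N \<omega>) {0<..h} = 0} \<longrightarrow> \<omega> \<in> (\<Union>i. E i)"
      using jump_free_void Y\<^sub>0_nonneg
      by eventually_elim (use h le in \<open>auto simp: E_def F_def\<close>)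
  qed measurable
  also have "\<dots> \<le> (\<Sum>i. emeasure M (E i))"
    by (intro emeasure_subadditive_countably) auto
  also have "\<dots> = (\<Sum>i. ennreal (exp (- (h * (h * real i)))) * emeasure M (F i))"
    unfolding E_def F_def emeasure_eq_measure
    using h by (subst prob_void_Int) (auto simp: jB ennreal_mult)
  also have "\<dots> = (\<Sum>i. \<integral>\<^sup>+\<omega>. ennreal (exp (- (h * (h * real i)))) * indicator (F i) \<omega> \<partial>M)"
    by (subst nn_integral_cmult_indicator) auto
  also have "\<dots> = (\<integral>\<^sup>+\<omega>. (\<Sum>i. ennreal (exp (- (h * (h * real i)))) * indicator (F i) \<omega>) \<partial>M)"
    by (rule nn_integral_suminf[symmetric]) measurable
  also have "\<dots> = (\<integral>\<^sup>+\<omega>. ennreal (exp (- (h * (h * real (j (X\<^sub>0 \<omega>, Y\<^sub>0 \<omega>)))))) \<partial>M)"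
  proof (rule nn_integral_cong)
    fix \<omega> assume "\<omega> \<in> space M"
    then have "(\<Sum>i. ennreal (exp (- (h * (h * real i)))) * indicator (F i) \<omega>) =
        (\<Sum>i\<in>{j (X\<^sub>0 \<omega>, Y\<^sub>0 \<omega>)}. ennreal (exp (- (h * (h * real i)))) * indicator (F i) \<omega>)"
      by (intro suminf_finite) (auto simp: F_def)
    with \<open>\<omega> \<in> space M\<close> show "(\<Sum>i. ennreal (exp (- (h * (h * real i)))) * indicator (F i) \<omega>) =
        ennreal (exp (- (h * (h * real (j (X\<^sub>0 \<omega>, Y\<^sub>0 \<omega>))))))"
      by (simp add: F_def)
  qed
  also have "\<dots> = ennreal (\<integral>\<omega>. exp (- (h * (h * real (j (X\<^sub>0 \<omega>, Y\<^sub>0 \<omega>))))) \<partial>M)"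
    using h by (intro nn_integral_eq_integral integrable_const_bound[where B=1]) (auto intro!: AE_I2)
  finally show ?thesis
    by (simp add: emeasure_eq_measure)
qed

text \<open>Rounding the level down costs at most \<open>h\<close>, which appears in the numerator on the left. The
  denominator comes from \<open>1 - exp (- x) \<ge> x / (1 + x)\<close>. As \<open>h \<rightarrow> 0\<close> the integrand tends to the
  initial intensity \<open>\<phi> (X\<^sub>0) + Y\<^sub>0\<close>.\<close>

lemma jump_probability_ge:
  assumes h: "0 < h"
  shows "(\<integral>\<^sup>+\<omega>. ennreal ((exp (- \<alpha> * h) * (\<phi> (X\<^sub>0 \<omega>) + Y\<^sub>0 \<omega>) - h) / (1 + h * (\<phi> (X\<^sub>0 \<omega>) + Y\<^sub>0 \<omega>))) \<partial>M)
    \<le> ennreal (prob {\<omega>\<in>space M. emeasure (N \<omega>) {0<..h} \<noteq> 0} / h)"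
proof -
  \<comment> \<open>the initial intensity, damped by its maximal decay up to \<open>h\<close>, in units of \<open>h\<close>\<close>
  define j where "j p = nat \<lfloor>exp (- \<alpha> * h) * (\<phi> (fst p) + snd p) / h\<rfloor>" for p :: "real \<times> real"
  define W where "W \<omega> = h * real (j (X\<^sub>0 \<omega>, Y\<^sub>0 \<omega>))" for \<omega>
  have j: "j \<in> measurable borel (count_space UNIV)"
    unfolding j_def borel_prod[symmetric] by measurable
  have pair [measurable]: "(\<lambda>\<omega>. (X\<^sub>0 \<omega>, Y\<^sub>0 \<omega>)) \<in> borel_measurable M"
    by (intro borel_measurable_Pair) measurable
  have [measurable]: "(\<lambda>\<omega>. j (X\<^sub>0 \<omega>, Y\<^sub>0 \<omega>)) \<in> measurable M (count_space UNIV)"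
    by (rule measurable_compose[OF pair j])
  have [measurable]: "W \<in> borel_measurable M"
    unfolding W_def by measurable
  have j_le: "h * real (j (x, y)) \<le> exp (- \<alpha> * h) * (\<phi> x + y)" 
    and j_ge: "exp (- \<alpha> * h) * (\<phi> x + y) - h \<le> h * real (j (x, y))" if "0 \<le> y" for x y
  proof -
    define q where "q = exp (- \<alpha> * h) * (\<phi> x + y) / h"
    have q: "0 \<le> q" "exp (- \<alpha> * h) * (\<phi> x + y) = h * q"
      using that h \<phi>_nonneg[of x] by (auto simp: q_def)
    then have "real (j (x, y)) = of_int \<lfloor>q\<rfloor>"
      by (simp add: j_def q_def)
    moreover have "of_int \<lfloor>q\<rfloor> \<le> q" "q - 1 \<le> of_int \<lfloor>q\<rfloor>"
      by linarith+
    ultimately have "h * real (j (x, y)) \<le> h * q" "h * (q - 1) \<le> h * real (j (x, y))"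
      using h by auto
    then show "h * real (j (x, y)) \<le> exp (- \<alpha> * h) * (\<phi> x + y)" 
      "exp (- \<alpha> * h) * (\<phi> x + y) - h \<le> h * real (j (x, y))"
      unfolding q(2) by (simp_all add: algebra_simps)
  qed
  have W0: "0 \<le> W \<omega>" for \<omega>
    using h by (simp add: W_def)
  have int: "integrable M (\<lambda>\<omega>. exp (- (h * W \<omega>)))"
    using h W0 by (intro integrable_const_bound[where B=1]) (auto intro!: AE_I2)
  have "(\<integral>\<^sup>+\<omega>. ennreal ((exp (- \<alpha> * h) * (\<phi> (X\<^sub>0 \<omega>) + Y\<^sub>0 \<omega>) - h) / (1 + h * (\<phi> (X\<^sub>0 \<omega>) + Y\<^sub>0 \<omega>))) \<partial>M)
      \<le> (\<integral>\<^sup>+\<omega>. ennreal ((1 - exp (- (h * W \<omega>))) / h) \<partial>M)"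
  proof (rule nn_integral_mono_AE)
    show "AE \<omega> in M. ennreal ((exp (- \<alpha> * h) * (\<phi> (X\<^sub>0 \<omega>) + Y\<^sub>0 \<omega>) - h) / (1 + h * (\<phi> (X\<^sub>0 \<omega>) + Y\<^sub>0 \<omega>)))
        \<le> ennreal ((1 - exp (- (h * W \<omega>))) / h)"
      using Y\<^sub>0_nonneg
    proof eventually_elim
      case (elim \<omega>)
      define v where "v = \<phi> (X\<^sub>0 \<omega>) + Y\<^sub>0 \<omega>"
      have v: "0 \<le> v" using \<phi>_nonneg elim by (simp add: v_def)
      have W: "W \<omega> \<le> exp (- \<alpha> * h) * v" "exp (- \<alpha> * h) * v - h \<le> W \<omega>"
        using j_le[OF elim] j_ge[OF elim] by (simp_all add: W_def v_def)
      have "exp (- \<alpha> * h) * v \<le> 1 * v"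
        using v h constants_pos by (intro mult_right_mono) auto
      then have Wv: "W \<omega> \<le> v" using W by simp
      have "(exp (- \<alpha> * h) * v - h) / (1 + h * v) \<le> W \<omega> / (1 + h * v)"
        using W v h by (intro divide_right_mono) auto
      also have "\<dots> \<le> W \<omega> / (1 + h * W \<omega>)"
        using Wv W0[of \<omega>] h v
        by (intro divide_left_mono add_left_mono mult_left_mono mult_pos_pos add_pos_nonneg) auto
      also have "\<dots> = (1 - 1 / (1 + h * W \<omega>)) / h"
      proof -
        have "1 + h * W \<omega> > 0" using W0[of \<omega>] h by (intro add_pos_nonneg) auto
        then have "1 - 1 / (1 + h * W \<omega>) = h * W \<omega> / (1 + h * W \<omega>)"
          by (simp add: diff_divide_eq_iff)
        then show ?thesis using h by simp
      qed
      also have "\<dots> \<le> (1 - exp (- (h * W \<omega>))) / h"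
      proof -
        have "exp (- (h * W \<omega>)) \<le> 1 / (1 + h * W \<omega>)"
          using exp_ge_add_one_self[of "h * W \<omega>"] W0[of \<omega>] h
          unfolding exp_minus inverse_eq_divide
          by (intro divide_left_mono mult_pos_pos add_pos_nonneg) auto
        then show ?thesis using h by (intro divide_right_mono) auto
      qed
      finally show ?case
        unfolding v_def by (rule ennreal_leI)
    qed
  qed
  also have "\<dots> = ennreal (\<integral>\<omega>. (1 - exp (- (h * W \<omega>))) / h \<partial>M)"
    using int h W0 by (intro nn_integral_eq_integral) (auto intro!: AE_I2)
  also have "(\<integral>\<omega>. (1 - exp (- (h * W \<omega>))) / h \<partial>M) = (1 - (\<integral>\<omega>. exp (- (h * W \<omega>)) \<partial>M)) / h"
    using int by (simp add: prob_space)
  also have "\<dots> \<le> prob {\<omega>\<in>space M. emeasure (N \<omega>) {0<..h} \<noteq> 0} / h"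
  proof (rule divide_right_mono)
    have "prob {\<omega>\<in>space M. emeasure (N \<omega>) {0<..h} \<noteq> 0} =
        1 - prob {\<omega>\<in>space M. emeasure (N \<omega>) {0<..h} = 0}"
      by (rule prob_neg) measurable
    moreover have "prob {\<omega>\<in>space M. emeasure (N \<omega>) {0<..h} = 0} \<le> (\<integral>\<omega>. exp (- (h * W \<omega>)) \<partial>M)"
      unfolding W_def using h j j_le by (rule jump_free_probability_le)
    ultimately show "1 - (\<integral>\<omega>. exp (- (h * W \<omega>)) \<partial>M) \<le>
        prob {\<omega>\<in>space M. emeasure (N \<omega>) {0<..h} \<noteq> 0}"
      by simp
  qed (use h in auto)
  finally show ?thesis
    by (simp add: ennreal_leI)
qed

text \<open>Up to time \<open>h\<close> both the initial excitation and that of a jump, if there is one, decay at most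
  by the factor \<open>exp (- \<alpha> h)\<close>.\<close>

lemma Y_ge_jump:
  assumes h: "0 < h"
  shows "AE \<omega> in M. exp (- \<alpha> * h) * (Y\<^sub>0 \<omega> + k * indicator {\<omega>\<in>space M. emeasure (N \<omega>) {0<..h} \<noteq> 0} \<omega>)
    \<le> Y h \<omega>"
  using N_finite AE_space
proof eventually_elim
  case (elim \<omega>)
  have Ioc: "{0<..h} \<in> sets (N \<omega>)"
    using Ioc_sets sets_N[OF elim(2)] by simp
  obtain n :: nat where n: "emeasure (N \<omega>) {0<..h} = of_nat n"
    using elim(1) h by blast
  let ?I = "LINT s:{0<..h}|N \<omega>. exp (- \<alpha> * (h - s))"
  have "exp (- \<alpha> * h) * indicator {\<omega>\<in>space M. emeasure (N \<omega>) {0<..h} \<noteq> 0} \<omega> \<le> ?I"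
  proof (cases "n = 0")
    case True
    have "0 \<le> ?I"
      unfolding set_lebesgue_integral_def by (intro integral_nonneg_AE) auto
    with True n show ?thesis by simp
  next
    case False
    have meas: "measure (N \<omega>) {0<..h} = real n"
      using n by (simp add: Sigma_Algebra.measure_def)
    have "exp (- \<alpha> * h) * indicator {\<omega>\<in>space M. emeasure (N \<omega>) {0<..h} \<noteq> 0} \<omega> \<le>
        exp (- \<alpha> * h) * real n"
      using False by (intro mult_left_mono) (auto simp: indicator_def)
    also have "\<dots> = (LINT s:{0<..h}|N \<omega>. exp (- \<alpha> * h))"
      using Ioc n by (subst set_integral_const) (simp_all add: meas)
    also have "\<dots> \<le> ?I"
    proof (rule set_integral_mono)
      show int: "set_integrable (N \<omega>) {0<..h} (\<lambda>s. exp (- \<alpha> * h))"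
        using Ioc n unfolding set_integrable_def by (intro integrable_indicator) (auto simp: of_nat_less_top)
      have int1: "integrable (N \<omega>) (\<lambda>s. indicator {0<..h} s :: real)"
        using Ioc n by (intro integrable_real_indicator) (auto simp: of_nat_less_top)
      have meas': "(\<lambda>s. indicator {0<..h} s *\<^sub>R exp (- \<alpha> * (h - s))) \<in> borel_measurable (N \<omega>)"
        unfolding measurable_cong_sets[OF sets_N[OF elim(2)] refl]
        by (intro measurable_restrict_space1) measurable
      show "set_integrable (N \<omega>) {0<..h} (\<lambda>s. exp (- \<alpha> * (h - s)))"
        unfolding set_integrable_def
        by (rule Bochner_Integration.integrable_bound[OF int1 meas'])
           (use constants_pos in \<open>auto intro!: AE_I2 simp: indicator_def\<close>)
      show "exp (- \<alpha> * h) \<le> exp (- \<alpha> * (h - s))" if "s \<in> {0<..h}" for s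
        using that constants_pos by auto
    qed
    finally show ?thesis .
  qed
  then have "k * (exp (- \<alpha> * h) * indicator {\<omega>\<in>space M. emeasure (N \<omega>) {0<..h} \<noteq> 0} \<omega>) \<le> k * ?I"
    using constants_pos by (intro mult_left_mono) auto
  then show ?case
    by (simp add: Y_def Y_path_def algebra_simps)
qed

text \<open>Taking means in the preceding bound, with \<open>Y\<close> having the same finite mean \<open>m\<close> at both times.\<close>

lemma jump_probability_le:
  assumes h: "0 < h"
    and eq: "(\<integral>\<^sup>+\<omega>. ennreal (Y h \<omega>) \<partial>M) = ennreal m" "(\<integral>\<^sup>+\<omega>. ennreal (Y\<^sub>0 \<omega>) \<partial>M) = ennreal m"
    and m: "0 \<le> m"
  shows "k * prob {\<omega>\<in>space M. emeasure (N \<omega>) {0<..h} \<noteq> 0} \<le> (exp (\<alpha> * h) - 1) * m"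
proof -
  define A where "A = {\<omega>\<in>space M. emeasure (N \<omega>) {0<..h} \<noteq> 0}"
  have A [measurable]: "A \<in> events" unfolding A_def by measurable
  have "ennreal (exp (- \<alpha> * h) * (m + k * prob A)) =
      ennreal (exp (- \<alpha> * h)) * (ennreal m + ennreal k * emeasure M A)"
    using m constants_pos by (simp add: ennreal_mult ennreal_plus emeasure_eq_measure)
  also have "\<dots> = ennreal (exp (- \<alpha> * h)) * (\<integral>\<^sup>+\<omega>. ennreal (Y\<^sub>0 \<omega>) + ennreal k * indicator A \<omega> \<partial>M)"
    by (subst nn_integral_add) (auto simp: eq nn_integral_cmult_indicator)
  also have "\<dots> = (\<integral>\<^sup>+\<omega>. ennreal (exp (- \<alpha> * h)) * (ennreal (Y\<^sub>0 \<omega>) + ennreal k * indicator A \<omega>) \<partial>M)"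
    by (rule nn_integral_cmult[symmetric]) measurable
  also have "\<dots> \<le> (\<integral>\<^sup>+\<omega>. ennreal (Y h \<omega>) \<partial>M)"
  proof (rule nn_integral_mono_AE)
    show "AE \<omega> in M. ennreal (exp (- \<alpha> * h)) * (ennreal (Y\<^sub>0 \<omega>) + ennreal k * indicator A \<omega>)
        \<le> ennreal (Y h \<omega>)"
      using Y_ge_jump[OF h] Y\<^sub>0_nonneg
    proof eventually_elim
      case (elim \<omega>)
      have "ennreal (exp (- \<alpha> * h)) * (ennreal (Y\<^sub>0 \<omega>) + ennreal k * indicator A \<omega>) =
          ennreal (exp (- \<alpha> * h) * (Y\<^sub>0 \<omega> + k * indicator A \<omega>))"
        using elim(2) constants_pos
        by (simp add: ennreal_mult ennreal_plus ennreal_indicator[symmetric])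
      also have "\<dots> \<le> ennreal (Y h \<omega>)"
        using elim(1) unfolding A_def by (rule ennreal_leI)
      finally show ?case .
    qed
  qed
  finally have "exp (- \<alpha> * h) * (m + k * prob A) \<le> m"
    using m by (simp add: eq)
  then have "exp (\<alpha> * h) * (exp (- \<alpha> * h) * (m + k * prob A)) \<le> exp (\<alpha> * h) * m"
    by (intro mult_left_mono) auto
  then have "m + k * prob A \<le> exp (\<alpha> * h) * m"
    by (simp add: mult.assoc[symmetric] exp_add[symmetric])
  then show ?thesis
    unfolding A_def by (simp add: algebra_simps)
qed

text \<open>The two estimates for the jump probability, divided by \<open>h\<close>, are compared as \<open>h \<rightarrow> 0\<close>, with
  Fatou's lemma on the lower side. In balance terms: the mean loss \<open>\<alpha> E[Y\<^sub>0]\<close> of excitation per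
  unit of time is at least the mean gain, which is \<open>k\<close> times the mean intensity.\<close>

lemma mean_intensity_le:
  assumes stat: "stationary_law (distr M path_space path)"
    and fin: "(\<integral>\<^sup>+\<omega>. ennreal (Y\<^sub>0 \<omega>) \<partial>M) < \<infinity>"
  shows "ennreal k * (\<integral>\<^sup>+\<omega>. ennreal (\<phi> (X\<^sub>0 \<omega>) + Y\<^sub>0 \<omega>) \<partial>M) \<le>
    ennreal \<alpha> * (\<integral>\<^sup>+\<omega>. ennreal (Y\<^sub>0 \<omega>) \<partial>M)"
proof -
  obtain m where m: "0 \<le> m" "(\<integral>\<^sup>+\<omega>. ennreal (Y\<^sub>0 \<omega>) \<partial>M) = ennreal m"
    using fin by (cases "\<integral>\<^sup>+\<omega>. ennreal (Y\<^sub>0 \<omega>) \<partial>M") auto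
  have Yh: "(\<integral>\<^sup>+\<omega>. ennreal (Y h \<omega>) \<partial>M) = ennreal m" if "0 < h" for h
    using stationary_nn_integral[OF stat, of h "\<lambda>p. ennreal (snd p)"] that m
    by (simp add: borel_prod[symmetric])
  define h where "h n = 1 / real (Suc n)" for n
  have h: "0 < h n" for n by (simp add: h_def)
  have h0: "h \<longlonglongrightarrow> 0"
    unfolding h_def by (rule LIMSEQ_Suc[OF lim_1_over_n])
  define f where "f n \<omega> = ennreal ((exp (- \<alpha> * h n) * (\<phi> (X\<^sub>0 \<omega>) + Y\<^sub>0 \<omega>) - h n) /
    (1 + h n * (\<phi> (X\<^sub>0 \<omega>) + Y\<^sub>0 \<omega>)))" for n \<omega>
  have [measurable]: "f n \<in> borel_measurable M" for n
    unfolding f_def by measurable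
  have f_le: "(\<integral>\<^sup>+\<omega>. f n \<omega> \<partial>M) \<le> ennreal ((exp (\<alpha> * h n) - 1) / h n * m / k)" for n
  proof -
    have "(\<integral>\<^sup>+\<omega>. f n \<omega> \<partial>M) \<le> ennreal (prob {\<omega>\<in>space M. emeasure (N \<omega>) {0<..h n} \<noteq> 0} / h n)"
      unfolding f_def by (rule jump_probability_ge[OF h])
    also have "\<dots> \<le> ennreal ((exp (\<alpha> * h n) - 1) / h n * m / k)"
      using jump_probability_le[OF h Yh[OF h] m(2) m(1), of n] constants_pos h[of n]
      by (intro ennreal_leI) (simp add: field_simps)
    finally show ?thesis .
  qed
  have f_lim: "(\<lambda>n. f n \<omega>) \<longlonglongrightarrow> ennreal (\<phi> (X\<^sub>0 \<omega>) + Y\<^sub>0 \<omega>)" for \<omega>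
  proof -
    define v where "v = \<phi> (X\<^sub>0 \<omega>) + Y\<^sub>0 \<omega>"
    have "(\<lambda>n. (exp (- \<alpha> * h n) * v - h n) / (1 + h n * v)) \<longlonglongrightarrow>
        (exp (- \<alpha> * 0) * v - 0) / (1 + 0 * v)"
      by (intro tendsto_intros h0) auto
    then show ?thesis
      unfolding f_def v_def[symmetric] by (intro tendsto_ennrealI) simp
  qed
  have bound_lim: "(\<lambda>n. ennreal ((exp (\<alpha> * h n) - 1) / h n * m / k)) \<longlonglongrightarrow> ennreal (\<alpha> * m / k)"
  proof -
    have "((\<lambda>x. exp (\<alpha> * x)) has_real_derivative \<alpha>) (at 0)"
      by (auto intro!: derivative_eq_intros)
    then have "((\<lambda>x. (exp (\<alpha> * x) - 1) / x) \<longlongrightarrow> \<alpha>) (at 0)"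
      by (simp add: DERIV_def)
    moreover have "filterlim h (at 0) sequentially"
      using h0 h by (auto simp: filterlim_at less_imp_neq[OF h, symmetric])
    ultimately have "(\<lambda>n. (exp (\<alpha> * h n) - 1) / h n) \<longlonglongrightarrow> \<alpha>"
      by (rule filterlim_compose)
    then show ?thesis
      using constants_pos by (intro tendsto_ennrealI tendsto_intros) auto
  qed
  have "(\<integral>\<^sup>+\<omega>. ennreal (\<phi> (X\<^sub>0 \<omega>) + Y\<^sub>0 \<omega>) \<partial>M) = (\<integral>\<^sup>+\<omega>. liminf (\<lambda>n. f n \<omega>) \<partial>M)"
    by (simp add: lim_imp_Liminf[OF _ f_lim])
  also have "\<dots> \<le> liminf (\<lambda>n. \<integral>\<^sup>+\<omega>. f n \<omega> \<partial>M)"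
    by (rule nn_integral_liminf) measurable
  also have "\<dots> \<le> liminf (\<lambda>n. ennreal ((exp (\<alpha> * h n) - 1) / h n * m / k))"
    using f_le by (intro Liminf_mono) auto
  also have "\<dots> = ennreal (\<alpha> * m / k)"
    by (rule lim_imp_Liminf[OF _ bound_lim]) simp
  finally have "ennreal k * (\<integral>\<^sup>+\<omega>. ennreal (\<phi> (X\<^sub>0 \<omega>) + Y\<^sub>0 \<omega>) \<partial>M) \<le> ennreal k * ennreal (\<alpha> * m / k)"
    by (rule mult_left_mono) simp
  also have "\<dots> = ennreal \<alpha> * ennreal m"
    using constants_pos m by (simp add: ennreal_mult[symmetric])
  finally show ?thesis
    using m by simp
qed


section \<open>Immigration does not vanish\<close>

text \<open>If the mean vanished, \<open>\<phi> (X)\<close> would be zero almost surely at every time, by stationarity. But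
  for some \<open>t\<close> and \<open>K\<close> the initial values satisfy \<open>\<phi> (X\<^sub>0 + c t) > 0\<close> and
  \<open>\<phi> (X\<^sub>0 + c t) + Y\<^sub>0 \<le> K\<close> with positive probability, and independently of this the field has
  no point in \<open>(0,t] \<times> [0,K]\<close> with positive probability. Then nothing stops \<open>X\<close> from rising to
  \<open>X\<^sub>0 + c t\<close>.\<close>

lemma immigration_pos:
  assumes stat: "stationary_law (distr M path_space path)"
  shows "(\<integral>\<^sup>+\<omega>. ennreal (\<phi> (X\<^sub>0 \<omega>)) \<partial>M) \<noteq> 0"
proof
  assume zero: "(\<integral>\<^sup>+\<omega>. ennreal (\<phi> (X\<^sub>0 \<omega>)) \<partial>M) = 0"
  have \<phi>0: "AE \<omega> in M. \<phi> (X s \<omega>) = 0" if "0 \<le> s" for s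
  proof -
    have "(\<integral>\<^sup>+\<omega>. ennreal (\<phi> (X s \<omega>)) \<partial>M) = 0"
      using stationary_nn_integral[OF stat that, of "\<lambda>p. ennreal (\<phi> (fst p))"] zero
      by (simp add: borel_prod[symmetric])
    then have "AE \<omega> in M. ennreal (\<phi> (X s \<omega>)) = 0"
      by (subst (asm) nn_integral_0_iff_AE) measurable
    then show ?thesis
      by eventually_elim (use \<phi>_nonneg in \<open>auto simp: ennreal_eq_0_iff intro: antisym\<close>)
  qed
  obtain l where l: "0 < \<phi> l"
  proof -
    have "eventually (\<lambda>x. 0 < \<phi> x) at_top"
      using admissible unfolding admissible_rate_def filterlim_at_top_dense by auto
    then show ?thesis using that by (auto simp: eventually_at_top_linorder)
  qed
  \<comment> \<open>initial values that reach \<open>l\<close> by time \<open>Suc n\<close> if there is no jump, with intensity below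
      \<open>K\<close> until then; these countably many sets cover the plane\<close>
  define C where "C n K = {p :: real \<times> real. l \<le> fst p + c * real (Suc n) \<and>
      \<phi> (fst p + c * real (Suc n)) + snd p \<le> real K}" for n K :: nat
  have C: "C n K \<in> sets borel" for n K
  proof -
    have "{p \<in> space (borel \<Otimes>\<^sub>M borel). l \<le> fst p + c * real (Suc n) \<and>
      \<phi> (fst p + c * real (Suc n)) + snd p \<le> real K} \<in> sets (borel \<Otimes>\<^sub>M borel)"
      by measurable
    then show ?thesis
      unfolding borel_prod C_def by simp
  qed
  have C_event: "{\<omega>\<in>space M. (X\<^sub>0 \<omega>, Y\<^sub>0 \<omega>) \<in> C n K} \<in> events" for n K
  proof -
    have "(\<lambda>\<omega>. (X\<^sub>0 \<omega>, Y\<^sub>0 \<omega>)) \<in> borel_measurable M"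
      by (intro borel_measurable_Pair) measurable
    from measurable_sets[OF this C[of n K]]
    show ?thesis
      by (simp add: vimage_def Int_def conj_commute)
  qed
  have null: "prob {\<omega>\<in>space M. (X\<^sub>0 \<omega>, Y\<^sub>0 \<omega>) \<in> C n K} = 0" for n K
  proof -
    let ?t = "real (Suc n)"
    let ?D = "{\<omega>\<in>space M. emeasure (\<Xi> \<omega>) (strip ?t (real K)) = 0} \<inter>
      {\<omega>\<in>space M. (X\<^sub>0 \<omega>, Y\<^sub>0 \<omega>) \<in> C n K}"
    have "AE \<omega> in M. \<omega> \<notin> ?D"
      using void_jump_free \<phi>0[of ?t, simplified] AE_space
    proof eventually_elim
      case (elim \<omega>)
      show ?case
      proof
        assume D: "\<omega> \<in> ?D"
        then have "emeasure (N \<omega>) {0<..?t} = 0"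
          using elim(1) by (auto simp: C_def)
        then have "X ?t \<omega> = X\<^sub>0 \<omega> + c * ?t"
          unfolding X_def by (rule X_path_jump_free)
        then have "\<phi> l \<le> \<phi> (X ?t \<omega>)"
          using D by (intro monoD[OF mono_\<phi>]) (auto simp: C_def)
        then show False
          using l elim(2) by simp
      qed
    qed
    moreover have "?D \<in> events"
      using C_event[of n K] by measurable
    ultimately have "prob ?D = 0"
      by (simp only: prob_eq_0)
    then show ?thesis
      by (subst (asm) prob_void_Int[OF _ _ C]) auto
  qed
  have "AE \<omega> in M. (X\<^sub>0 \<omega>, Y\<^sub>0 \<omega>) \<notin> C n K" for n K
  proof -
    have "AE \<omega> in M. \<omega> \<notin> {\<omega>\<in>space M. (X\<^sub>0 \<omega>, Y\<^sub>0 \<omega>) \<in> C n K}"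
      using null[of n K] by (simp only: prob_eq_0[OF C_event])
    with AE_space show ?thesis
      by eventually_elim auto
  qed
  then have "AE \<omega> in M. \<forall>n K. (X\<^sub>0 \<omega>, Y\<^sub>0 \<omega>) \<notin> C n K"
    by (simp add: AE_all_countable)
  moreover have "\<exists>n K. (x, y) \<in> C n K" for x y
  proof -
    obtain n where "(l - x) / c \<le> real n"
      using real_arch_simple by blast
    then have "l \<le> x + c * real (Suc n)"
      using constants_pos by (simp add: field_simps)
    moreover obtain K where "\<phi> (x + c * real (Suc n)) + y \<le> real K"
      using real_arch_simple by blast
    ultimately show ?thesis
      unfolding C_def by fastforce
  qed
  ultimately have "AE \<omega> in M. False"
    by (elim eventually_mono) blast
  then show False
    by simp
qed

text \<open>For \<open>a = E[\<phi> (X\<^sub>0)]\<close> and \<open>b = E[Y\<^sub>0]\<close> the balance reads \<open>k (a + b) \<le> \<alpha> b\<close>, and strictness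
  is due to \<open>a > 0\<close>.\<close>

theorem stationary_branching_ratio_less_1:
  assumes stat: "stationary_law (distr M path_space path)" and t: "0 \<le> t"
    and fin: "(\<integral>\<^sup>+\<omega>. ennreal (intensity t \<omega>) \<partial>M) < \<infinity>"
  shows "k / \<alpha> < 1"
proof -
  let ?a = "\<integral>\<^sup>+\<omega>. ennreal (\<phi> (X\<^sub>0 \<omega>)) \<partial>M" and ?b = "\<integral>\<^sup>+\<omega>. ennreal (Y\<^sub>0 \<omega>) \<partial>M"
  have "(\<integral>\<^sup>+\<omega>. ennreal (intensity t \<omega>) \<partial>M) = (\<integral>\<^sup>+\<omega>. ennreal (\<phi> (X\<^sub>0 \<omega>) + Y\<^sub>0 \<omega>) \<partial>M)"
    using stationary_nn_integral[OF stat t, of "\<lambda>p. ennreal (\<phi> (fst p) + snd p)"]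
    by (simp add: borel_prod[symmetric] intensity_def intensity_path_def X_def Y_def)
  moreover have sum: "(\<integral>\<^sup>+\<omega>. ennreal (\<phi> (X\<^sub>0 \<omega>) + Y\<^sub>0 \<omega>) \<partial>M) = ?a + ?b"
  proof -
    have "(\<integral>\<^sup>+\<omega>. ennreal (\<phi> (X\<^sub>0 \<omega>) + Y\<^sub>0 \<omega>) \<partial>M) = (\<integral>\<^sup>+\<omega>. ennreal (\<phi> (X\<^sub>0 \<omega>)) + ennreal (Y\<^sub>0 \<omega>) \<partial>M)"
      using Y\<^sub>0_nonneg by (intro nn_integral_cong_AE, eventually_elim) (simp add: \<phi>_nonneg)
    then show ?thesis
      by (simp add: nn_integral_add)
  qed
  ultimately have "?a + ?b < \<infinity>"
    using fin by simp
  then obtain a b where ab: "0 \<le> a" "0 \<le> b" "?a = ennreal a" "?b = ennreal b"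
    by (cases ?a; cases ?b) auto
  have "0 < a"
    using immigration_pos[OF stat] ab by (cases "a = 0") auto
  have "ennreal (k * (a + b)) \<le> ennreal (\<alpha> * b)"
    using mean_intensity_le[OF stat] ab constants_pos by (simp add: sum ennreal_mult ennreal_plus)
  then have "k * (a + b) \<le> \<alpha> * b"
    using ab constants_pos by simp
  moreover have "0 < k * a"
    using \<open>0 < a\<close> constants_pos by simp
  ultimately have "k * b < \<alpha> * b"
    by (simp add: algebra_simps)
  then have "k < \<alpha>"
    using ab by (simp add: mult_less_cancel_right)
  then show ?thesis
    using constants_pos by simp
qed

end

theorem mainTheorem1:
  fixes M :: "'w measure"
    and c \<alpha> k :: real
    and \<phi> :: "real \<Rightarrow> real"
    and \<Xi> :: "'w \<Rightarrow> (real \<times> real) measure"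
    and Z :: "nat \<Rightarrow> 'w \<Rightarrow> real"
    and X\<^sub>0 Y\<^sub>0 :: "'w \<Rightarrow> real"
    and N :: "'w \<Rightarrow> real measure"
    and t :: real
  assumes "self_exciting_model M c \<alpha> k \<phi> \<Xi> Z X\<^sub>0 Y\<^sub>0 N"
    and "stationary_law
          (distr M path_space (self_exciting_model.path c \<alpha> k Z X\<^sub>0 Y\<^sub>0 N))"
    and "ergodic_law
          (distr M path_space (self_exciting_model.path c \<alpha> k Z X\<^sub>0 Y\<^sub>0 N))"
    and "0 \<le> t"
    and "0 < (\<integral>\<^sup>+\<omega>. ennreal (self_exciting_model.intensity c \<alpha> k \<phi> Z X\<^sub>0 Y\<^sub>0 N t \<omega>) \<partial>M)"
    and "(\<integral>\<^sup>+\<omega>. ennreal (self_exciting_model.intensity c \<alpha> k \<phi> Z X\<^sub>0 Y\<^sub>0 N t \<omega>) \<partial>M) < \<infinity>"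
  shows "k / \<alpha> < 1"
  using assms(2,4,6)
  by (rule self_exciting_model.stationary_branching_ratio_less_1[OF assms(1)])

end
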